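(* Let $\Sigma_f$ be a rotational surface in $\mathbb{R}^3$, where $f:I\to\mathbb{R}$ is a positive smooth function on an open interval $I\subseteq\mathbb{R}$. Suppose that the Gaussian curvature of $\Sigma_f$ vanishes identically. Then $f$ is an affine function and $\Sigma_f$ is part of either a right circular cylinder $\mathcal{C}_0(r)$, or a cone $\mathcal{K}_v(\varphi)$, or an extended plane $\mathcal{P}_0$.
   Context: Rotational surfaces: let $I\subseteq\mathbb{R}$ be an open interval, and let $f,g:I\to\mathbb{R}$ be smooth with $f>0$, $(f')^2+(g')^2=1$, $g'\ge 0$ and, without loss of generality up to a vertical isometry of $\mathbb{R}^3$, $g(s_0)=0$ for some $s_0\in I$, i.e. $g(s)=\int_{s_0}^s\sqrt{1-f'(\zeta)^2}\,d\zeta$. The rotational surface $\Sigma_f\subset\mathbb{R}^3$ is the surface parametrised by $X(s,\theta)=(f(s)\cos\theta,f(s)\sin\theta,g(s))$. The induced metric is $ds^2+f(s)^2d\theta^2$ and the Gaussian curvature is $K=-f''/f$. Notation: for $r>0$, $\mathcal{C}_0(r)$ is the right circular cylinder of radius $r$ about the $z$-axis; for $\varphi\in(0,\pi)$ and $v\in\mathbb{R}$, $\mathcal{K}_v(\varphi)$ is the right circular cone about the $z$-axis with opening angle $\varphi$ and vertex $(0,0,v)$; for $z_0\in\mathbb{R}$, $\mathcal{P}_{z_0}$ is the horizontal plane $\{z=z_0\}$, which is regarded as an (extended) rotational surface although the distance to the axis vanishes at one point. *)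

theory Defs
  imports "HOL-Analysis.Analysis"
begin

text \<open>Smoothness on an open set of reals: all iterated derivatives exist at every point of \<open>I\<close>.
  On an open set, values of \<open>h\<close> outside \<open>I\<close> are irrelevant.\<close>

definition smooth_on_open :: "real set \<Rightarrow> (real \<Rightarrow> real) \<Rightarrow> bool" where
  "smooth_on_open I h \<longleftrightarrow>
     (\<forall>n. \<forall>x\<in>I. (deriv ^^ n) h field_differentiable (at x))"

definition partial1 :: "(real \<Rightarrow> real \<Rightarrow> real^3) \<Rightarrow> real \<Rightarrow> real \<Rightarrow> real^3" where
  "partial1 X u v = vector_derivative (\<lambda>s. X s v) (at u)"

definition partial2 :: "(real \<Rightarrow> real \<Rightarrow> real^3) \<Rightarrow> real \<Rightarrow> real \<Rightarrow> real^3" where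
  "partial2 X u v = vector_derivative (\<lambda>t. X u t) (at v)"

definition unit_normal :: "(real \<Rightarrow> real \<Rightarrow> real^3) \<Rightarrow> real \<Rightarrow> real \<Rightarrow> real^3" where
  "unit_normal X u v = sgn (cross3 (partial1 X u v) (partial2 X u v))"

text \<open>Gaussian curvature of a parametrised surface at \<open>X u v\<close>, as the quotient of the
  determinants of the second and the first fundamental form. It is meaningful where \<open>X\<close> is twice
  differentiable and regular (the denominator is nonzero).\<close>

definition gauss_curvature :: "(real \<Rightarrow> real \<Rightarrow> real^3) \<Rightarrow> real \<Rightarrow> real \<Rightarrow> real" where
  "gauss_curvature X u v =
     (let Xu = partial1 X u v; Xv = partial2 X u v; N = unit_normal X u v;
          E = Xu \<bullet> Xu; F = Xu \<bullet> Xv; G = Xv \<bullet> Xv;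
          L = partial1 (partial1 X) u v \<bullet> N;
          M = partial2 (partial1 X) u v \<bullet> N;
          P = partial2 (partial2 X) u v \<bullet> N
      in (L * P - M\<^sup>2) / (E * G - F\<^sup>2))"

definition rot_param :: "(real \<Rightarrow> real) \<Rightarrow> (real \<Rightarrow> real) \<Rightarrow> real \<Rightarrow> real \<Rightarrow> real^3" where
  "rot_param f g s \<theta> = vector [f s * cos \<theta>, f s * sin \<theta>, g s]"

definition rot_surface :: "real set \<Rightarrow> (real \<Rightarrow> real) \<Rightarrow> (real \<Rightarrow> real) \<Rightarrow> (real^3) set" where
  "rot_surface I f g = {rot_param f g s \<theta> | s \<theta>. s \<in> I}"

definition cylinder0 :: "real \<Rightarrow> (real^3) set" where
  "cylinder0 r = {p. (p $ 1)\<^sup>2 + (p $ 2)\<^sup>2 = r\<^sup>2}"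

text \<open>The double cone with axis the \<open>z\<close>-axis and vertex \<open>(0,0,v)\<close>. The opening angle \<open>\<phi>\<close> in
  \<open>(0,\<pi>)\<close> is the full angle at the vertex, so the generating lines make the angle \<open>\<phi>/2\<close> with the
  axis.\<close>

definition right_cone :: "real \<Rightarrow> real \<Rightarrow> (real^3) set" where
  "right_cone v \<phi> = {p. sqrt ((p $ 1)\<^sup>2 + (p $ 2)\<^sup>2) = tan (\<phi> / 2) * \<bar>p $ 3 - v\<bar>}"

definition horizontal_plane :: "real \<Rightarrow> (real^3) set" where
  "horizontal_plane z0 = {p. p $ 3 = z0}"

end

theory Submission
  imports Defs
begin

text \<open>The curvature equation reads \<open>(f' g'' - f'' g') g' = 0\<close>; differentiating
  \<open>f'\<^sup>2 + g'\<^sup>2 = 1\<close> gives \<open>f' f'' + g' g'' = 0\<close>, so the left side is just \<open>- f''\<close>. Hence \<open>f'\<close> is a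
  constant \<open>a\<close> and \<open>g' = sqrt (1 - a\<^sup>2)\<close>; the cases \<open>a = 0\<close>, \<open>\<bar>a\<bar> = 1\<close> and \<open>0 < \<bar>a\<bar> < 1\<close> give the
  cylinder, the plane and the cone.\<close>

text \<open>Expanding the vector in the standard basis leaves only sums and scalar multiples to
  differentiate. Every partial derivative of the parametrisation is computed through this
  rule.\<close>

lemma has_vector_derivative_vector_3:
  fixes p q r :: "real \<Rightarrow> real"
  assumes "(p has_real_derivative p') (at x)"
    and "(q has_real_derivative q') (at x)"
    and "(r has_real_derivative r') (at x)"
  shows "((\<lambda>t. vector [p t, q t, r t] :: real^3) has_vector_derivative vector [p', q', r']) (at x)"
proof -
  have eq: "(vector [a, b, c] :: real^3) = a *\<^sub>R axis 1 1 + b *\<^sub>R axis 2 1 + c *\<^sub>R axis 3 1"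
    for a b c :: real
    by (simp add: vec_eq_iff forall_3 axis_def)
  show ?thesis
    unfolding eq using assms
    by (auto intro!: derivative_eq_intros simp: has_real_derivative_iff_has_vector_derivative)
qed

text \<open>The instances \<open>n = 0\<close> and \<open>n = 1\<close> of smoothness; curvature
  involves no derivative beyond the second.\<close>

lemma smooth_DERIV:
  assumes "smooth_on_open I h" "s \<in> I"
  shows "(h has_real_derivative deriv h s) (at s)"
    and "(deriv h has_real_derivative deriv (deriv h) s) (at s)"
  using assms(1)[unfolded smooth_on_open_def, rule_format, of s 0]
    assms(1)[unfolded smooth_on_open_def, rule_format, of s 1] assms(2)
  by (simp_all add: DERIV_deriv_iff_field_differentiable)

context
  fixes I :: "real set" and f g :: "real \<Rightarrow> real"
  assumes I: "open I"
    and f: "smooth_on_open I f" and g: "smooth_on_open I g"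
begin

lemma partial1_rot_param:
  assumes "s \<in> I"
  shows "partial1 (rot_param f g) s \<theta> = vector [deriv f s * cos \<theta>, deriv f s * sin \<theta>, deriv g s]"
  unfolding partial1_def rot_param_def
  by (intro vector_derivative_at has_vector_derivative_vector_3 DERIV_cmult_right
      smooth_DERIV(1)[OF f assms] smooth_DERIV(1)[OF g assms])

lemma partial2_rot_param:
  "partial2 (rot_param f g) s \<theta> = vector [- (f s * sin \<theta>), f s * cos \<theta>, 0]"
  unfolding partial2_def rot_param_def
  by (intro vector_derivative_at has_vector_derivative_vector_3)
    (auto intro!: derivative_eq_intros)

lemma partial11_rot_param:
  assumes "s \<in> I"
  shows "partial1 (partial1 (rot_param f g)) s \<theta> =
    vector [deriv (deriv f) s * cos \<theta>, deriv (deriv f) s * sin \<theta>, deriv (deriv g) s]"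
proof -
  have "((\<lambda>u. vector [deriv f u * cos \<theta>, deriv f u * sin \<theta>, deriv g u] :: real^3)
      has_vector_derivative
      vector [deriv (deriv f) s * cos \<theta>, deriv (deriv f) s * sin \<theta>, deriv (deriv g) s]) (at s)"
    by (intro has_vector_derivative_vector_3 DERIV_cmult_right
        smooth_DERIV(2)[OF f assms] smooth_DERIV(2)[OF g assms])
  \<comment> \<open>The explicit formula for the first partial derivative is known only at
    parameters in \<open>I\<close>. Since \<open>I\<close> is open, the agreement holds near
    \<open>s\<close>, so the derivative transfers.\<close>
  then have "((\<lambda>u. partial1 (rot_param f g) u \<theta>) has_vector_derivative
      vector [deriv (deriv f) s * cos \<theta>, deriv (deriv f) s * sin \<theta>, deriv (deriv g) s]) (at s)"
    by (rule has_vector_derivative_transform_within_open[OF _ I assms])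
      (simp add: partial1_rot_param)
  then show ?thesis
    unfolding partial1_def[of "partial1 (rot_param f g)"] by (rule vector_derivative_at)
qed

lemma partial12_rot_param:
  assumes "s \<in> I"
  shows "partial2 (partial1 (rot_param f g)) s \<theta> =
    vector [- (deriv f s * sin \<theta>), deriv f s * cos \<theta>, 0]"
  unfolding partial2_def[of "partial1 (rot_param f g)"] partial1_rot_param[OF assms]
  by (intro vector_derivative_at has_vector_derivative_vector_3)
    (auto intro!: derivative_eq_intros)

lemma partial22_rot_param:
  "partial2 (partial2 (rot_param f g)) s \<theta> = vector [- (f s * cos \<theta>), - (f s * sin \<theta>), 0]"
  unfolding partial2_def[of "partial2 (rot_param f g)"] partial2_rot_param
  by (intro vector_derivative_at has_vector_derivative_vector_3)
    (auto intro!: derivative_eq_intros)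

text \<open>The cross product is \<open>f s\<close> times \<open>?N\<close>. Unit speed of the
  profile curve makes \<open>?N\<close> a unit vector, and \<open>sgn\<close> strips the positive
  factor.\<close>

lemma unit_normal_rot_param:
  assumes "s \<in> I" "f s > 0" "(deriv f s)\<^sup>2 + (deriv g s)\<^sup>2 = 1"
  shows "unit_normal (rot_param f g) s \<theta> =
    vector [- (deriv g s * cos \<theta>), - (deriv g s * sin \<theta>), deriv f s]" (is "_ = ?N")
proof -
  have sc: "sin \<theta> * (sin \<theta> * x) = x - cos \<theta> * (cos \<theta> * x)" for x :: real
    using sin_cos_squared_add[of \<theta>] by algebra
  have "cross3 (partial1 (rot_param f g) s \<theta>) (partial2 (rot_param f g) s \<theta>) = f s *\<^sub>R ?N"
    by (simp add: partial1_rot_param[OF assms(1)] partial2_rot_param cross3_def vec_eq_iff forall_3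
        algebra_simps sc)
  moreover have "?N \<bullet> ?N = (deriv f s)\<^sup>2 + (deriv g s)\<^sup>2"
    by (simp add: inner_vec_def sum_3) (use sin_cos_squared_add[of \<theta>] in algebra)
  then have "norm ?N = 1"
    using assms(3) by (simp add: norm_eq_sqrt_inner)
  ultimately show ?thesis
    using assms(2) by (simp add: unit_normal_def sgn_scaleR) (simp add: sgn_div_norm)
qed

text \<open>Both fundamental forms are diagonal, with first form \<open>1, f\<^sup>2\<close> and
  second form \<open>f' g'' - f'' g', f g'\<close>. The unit-speed identity is assumed on all of
  \<open>I\<close> because it gets differentiated.\<close>

lemma gauss_curvature_rot_param:
  assumes "s \<in> I" "f s > 0" "\<And>s. s \<in> I \<Longrightarrow> (deriv f s)\<^sup>2 + (deriv g s)\<^sup>2 = 1"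
  shows "gauss_curvature (rot_param f g) s \<theta> = - deriv (deriv f) s / f s"
proof -
  let ?X = "rot_param f g" and ?f' = "deriv f s" and ?g' = "deriv g s"
    and ?f'' = "deriv (deriv f) s" and ?g'' = "deriv (deriv g) s"
  note sc = sin_cos_squared_add[of \<theta>] and unit = assms(3)[OF assms(1)]
  note N = unit_normal_rot_param[OF assms(1,2) unit]
  have "((\<lambda>u. (deriv f u)\<^sup>2 + (deriv g u)\<^sup>2) has_real_derivative 2 * (?f' * ?f'' + ?g' * ?g'')) (at s)"
    using smooth_DERIV(2)[OF f assms(1)] smooth_DERIV(2)[OF g assms(1)]
    by (auto intro!: derivative_eq_intros simp: algebra_simps)
  \<comment> \<open>The same function equals 1 throughout the open set \<open>I\<close>, so
    uniqueness of derivatives yields the orthogonality of velocity and acceleration.\<close>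
  moreover have "((\<lambda>u. (deriv f u)\<^sup>2 + (deriv g u)\<^sup>2) has_real_derivative 0) (at s)"
    by (rule has_field_derivative_transform_within_open[OF DERIV_const[of 1] I assms(1)])
      (simp add: assms(3))
  ultimately have orth: "?f' * ?f'' + ?g' * ?g'' = 0"
    using DERIV_unique by fastforce
  have E: "partial1 ?X s \<theta> \<bullet> partial1 ?X s \<theta> = 1"
    unfolding partial1_rot_param[OF assms(1)]
    by (simp add: inner_vec_def sum_3) (use sc unit in algebra)
  have F: "partial1 ?X s \<theta> \<bullet> partial2 ?X s \<theta> = 0"
    unfolding partial1_rot_param[OF assms(1)] partial2_rot_param
    by (simp add: inner_vec_def sum_3)
  have G: "partial2 ?X s \<theta> \<bullet> partial2 ?X s \<theta> = (f s)\<^sup>2"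
    unfolding partial2_rot_param
    by (simp add: inner_vec_def sum_3) (use sc in algebra)
  have L: "partial1 (partial1 ?X) s \<theta> \<bullet> unit_normal ?X s \<theta> = ?f' * ?g'' - ?f'' * ?g'"
    unfolding partial11_rot_param[OF assms(1)] N
    by (simp add: inner_vec_def sum_3) (use sc in algebra)
  have M: "partial2 (partial1 ?X) s \<theta> \<bullet> unit_normal ?X s \<theta> = 0"
    unfolding partial12_rot_param[OF assms(1)] N
    by (simp add: inner_vec_def sum_3)
  have P: "partial2 (partial2 ?X) s \<theta> \<bullet> unit_normal ?X s \<theta> = f s * ?g'"
    unfolding partial22_rot_param N
    by (simp add: inner_vec_def sum_3) (use sc in algebra)
  \<comment> \<open>Replace \<open>?g' * ?g''\<close> by \<open>- ?f' * ?f''\<close>; then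
    \<open>- ?f''\<close> factors out, multiplied by the squared speed 1.\<close>
  have "(?f' * ?g'' - ?f'' * ?g') * (f s * ?g') = - ?f'' * f s"
    using orth unit by algebra
  then show ?thesis
    using assms(2) by (simp add: gauss_curvature_def Let_def E F G L M P power2_eq_square)
qed

end

text \<open>Subtracting \<open>c * s\<close> leaves a function with zero derivative on a connected
  open set. The lemma integrates three times below: \<open>deriv f\<close> with slope 0, then
  \<open>f\<close> and \<open>g\<close>.\<close>

lemma affine_if_deriv_const:
  fixes h :: "real \<Rightarrow> real"
  assumes "open I" "connected I" "t \<in> I"
    and "\<And>s. s \<in> I \<Longrightarrow> (h has_real_derivative c) (at s)" and "s \<in> I"
  shows "h s = h t + c * (s - t)"
proof -
  have "(\<lambda>s. h s - c * s) constant_on I"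
  proof (rule has_field_derivative_0_imp_constant_on[OF _ assms(2,1)])
    show "((\<lambda>s. h s - c * s) has_real_derivative 0) (at u)" if "u \<in> I" for u
      using assms(4)[OF that] by (auto intro!: derivative_eq_intros)
  qed
  then show ?thesis
    using assms(3,5) by (fastforce simp: constant_on_def algebra_simps)
qed

lemma rot_surface_subset_iff:
  "rot_surface I f g \<subseteq> A \<longleftrightarrow> (\<forall>s\<in>I. \<forall>\<theta>. rot_param f g s \<theta> \<in> A)"
  by (auto simp: rot_surface_def)

theorem proposition3p1:
  fixes I :: "real set" and f g :: "real \<Rightarrow> real" and s0 :: real
  assumes "open I" and "is_interval I" and "s0 \<in> I"
    and "smooth_on_open I f" and "smooth_on_open I g"
    and "\<And>s. s \<in> I \<Longrightarrow> f s > 0"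
    and "\<And>s. s \<in> I \<Longrightarrow> (deriv f s)\<^sup>2 + (deriv g s)\<^sup>2 = 1"
    and "\<And>s. s \<in> I \<Longrightarrow> deriv g s \<ge> 0"
    and "g s0 = 0"
    and "\<And>s \<theta>. s \<in> I \<Longrightarrow> gauss_curvature (rot_param f g) s \<theta> = 0"
  shows "(\<exists>a b. \<forall>s\<in>I. f s = a * s + b) \<and>
    ((\<exists>r>0. rot_surface I f g \<subseteq> cylinder0 r) \<or>
     (\<exists>v \<phi>. 0 < \<phi> \<and> \<phi> < pi \<and> rot_surface I f g \<subseteq> right_cone v \<phi>) \<or>
     rot_surface I f g \<subseteq> horizontal_plane 0)"
proof -
  have conn: "connected I"
    using assms(2) by (rule is_interval_connected)
  define a where "a = deriv f s0"
  define b where "b = f s0 - a * s0"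
  define c where "c = sqrt (1 - a\<^sup>2)"
  have f'': "deriv (deriv f) s = 0" if "s \<in> I" for s
    using gauss_curvature_rot_param[OF assms(1,4,5) that assms(6)[OF that] assms(7)]
      assms(6)[OF that] assms(10)[OF that] by simp
  have f': "deriv f s = a" if "s \<in> I" for s
    using affine_if_deriv_const[OF assms(1) conn assms(3) _ that, of "deriv f" 0]
      smooth_DERIV(2)[OF assms(4)] f'' unfolding a_def by fastforce
  \<comment> \<open>Unit speed determines \<open>deriv g s\<close> up to sign; its nonnegativity
    selects the root \<open>c\<close>.\<close>
  have g': "deriv g s = c" if "s \<in> I" for s
    using assms(7,8)[OF that] f'[OF that] unfolding c_def
    by (metis add_diff_cancel_left' real_sqrt_unique)
  have f: "f s = a * s + b" if "s \<in> I" for s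
    using affine_if_deriv_const[OF assms(1) conn assms(3) _ that, of f a]
      smooth_DERIV(1)[OF assms(4)] f' unfolding b_def by (fastforce simp: algebra_simps)
  \<comment> \<open>The normalisation \<open>g s0 = 0\<close> removes the additive constant, which
    later puts the plane at height 0.\<close>
  have g: "g s = c * (s - s0)" if "s \<in> I" for s
    using affine_if_deriv_const[OF assms(1) conn assms(3) _ that, of g c]
      smooth_DERIV(1)[OF assms(5)] g' assms(9) by fastforce
  have circle: "(x * cos \<theta>)\<^sup>2 + (x * sin \<theta>)\<^sup>2 = x\<^sup>2" for x \<theta> :: real
    using sin_cos_squared_add[of \<theta>] by algebra
  have "c \<ge> 0"
    using assms(8)[OF assms(3)] g'[OF assms(3)] by simp
  consider "a = 0" | "c = 0" | "a \<noteq> 0" "c > 0"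
    using \<open>c \<ge> 0\<close> by fastforce
  then have "(\<exists>r>0. rot_surface I f g \<subseteq> cylinder0 r) \<or>
     (\<exists>v \<phi>. 0 < \<phi> \<and> \<phi> < pi \<and> rot_surface I f g \<subseteq> right_cone v \<phi>) \<or>
     rot_surface I f g \<subseteq> horizontal_plane 0"
  proof cases
    case 1
    have "b > 0"
      using assms(6)[OF assms(3)] f[OF assms(3)] 1 by simp
    moreover have "rot_surface I f g \<subseteq> cylinder0 b"
      using 1 f by (simp add: rot_surface_subset_iff cylinder0_def rot_param_def circle)
    ultimately show ?thesis by blast
  next
    case 2
    then have "rot_surface I f g \<subseteq> horizontal_plane 0"
      using g by (simp add: rot_surface_subset_iff horizontal_plane_def rot_param_def)
    then show ?thesis by blast
  next
    case 3
    \<comment> \<open>The profile line meets the axis at the parameter \<open>- b / a\<close>.\<close>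
    define v where "v = c * (- b / a - s0)"
    \<comment> \<open>In the half-plane of radius and height the profile has direction
      \<open>(a, c)\<close>, so its angle with the axis has tangent
      \<open>\<bar>a\<bar> / c\<close>. The opening angle is twice that.\<close>
    define \<phi> where "\<phi> = 2 * arctan (\<bar>a\<bar> / c)"
    have "0 < \<phi>" "\<phi> < pi"
      using 3 arctan_ubound[of "\<bar>a\<bar> / c"] by (simp_all add: \<phi>_def)
    moreover have "rot_param f g s \<theta> \<in> right_cone v \<phi>" if "s \<in> I" for s \<theta>
    proof -
      \<comment> \<open>Here \<open>f s / a = s + b / a\<close> is the signed parameter distance
        from the vertex. Taking absolute values next covers both signs of \<open>a\<close>, that is,
        both nappes of the cone.\<close>
      have "g s - v = c * (f s / a)"
        using 3 unfolding f[OF that] g[OF that] v_def by (simp add: field_simps)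
      then have "tan (\<phi> / 2) * \<bar>g s - v\<bar> = f s"
        using 3 assms(6)[OF that] by (simp add: abs_mult \<phi>_def tan_arctan)
      then show ?thesis
        using assms(6)[OF that] by (simp add: right_cone_def rot_param_def circle)
    qed
    then have "rot_surface I f g \<subseteq> right_cone v \<phi>"
      by (simp add: rot_surface_subset_iff)
    ultimately show ?thesis by blast
  qed
  then show ?thesis
    using f by blast
qed

end
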